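(* Let $k=2^{\ell+1}$ for some positive integer $\ell$ and let $t$ be an integer with $2^\ell\le t\le k-1$. For $\alpha=(1,1,\ldots, 1, 0,\ldots, 0)\in \mathbb F_2^k$ with the first $t$ coordinates being one and the remaining coordinates being zero, we have, as $n\to\infty$, $$f_\alpha(n)\sim \left((2^\ell)!\, n\right)^{1/2^\ell}.$$
   Context: Let $[n]=\{1,\ldots,n\}$. For $\alpha=(a_1,\ldots,a_k)\in\mathbb F_2^k$, a family $\mathcal F\subset 2^{[n]}$ is an $\alpha$-intersecting family (modulo $2$) if for each $j\in[k]$ and any $j$ distinct members $F_1,\ldots,F_j\in\mathcal F$ one has $|F_1\cap\cdots\cap F_j|\equiv a_j \pmod 2$. Let $f_\alpha(n)$ be the maximum size of an $\alpha$-intersecting family $\mathcal F\subset 2^{[n]}$. $f\sim g$ means $\lim_{n\to\infty}f(n)/g(n)=1$. *)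

theory Defs
  imports "HOL-Library.Z2" "HOL-Library.Landau_Symbols" "HOL-Analysis.Analysis"
begin

text \<open>
  The vector \<open>\<alpha> = (a\<^sub>1, \<dots>, a\<^sub>k)\<close> over the field \<^typ>\<open>bit\<close> with two elements is the list
  of its coordinates, so \<open>k = length \<alpha>\<close> and \<open>a\<^sub>j = \<alpha> ! (j - 1)\<close>. A choice of \<open>j\<close> distinct members
  of \<open>\<F>\<close> is a subfamily \<open>\<G> \<subseteq> \<F>\<close> with \<open>card \<G> = j\<close>; it is finite and nonempty because \<open>j \<ge> 1\<close>.
  Families with fewer than \<open>j\<close> members satisfy the condition for \<open>j\<close> vacuously.
\<close>

definition alpha_intersecting :: "bit list \<Rightarrow> nat \<Rightarrow> nat set set \<Rightarrow> bool" where
  "alpha_intersecting \<alpha> n \<F> \<longleftrightarrow>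
     \<F> \<subseteq> Pow {1..n} \<and>
     (\<forall>j\<in>{1..length \<alpha>}. \<forall>\<G>\<subseteq>\<F>. card \<G> = j \<longrightarrow> of_nat (card (\<Inter>\<G>)) = \<alpha> ! (j - 1))"

definition max_alpha_intersecting :: "bit list \<Rightarrow> nat \<Rightarrow> nat" where
  "max_alpha_intersecting \<alpha> n = Max {card \<F> | \<F>. alpha_intersecting \<alpha> n \<F>}"

text \<open>The maximum is over a finite nonempty set, as \<^const>\<open>Max\<close> requires.\<close>

lemma finite_card_alpha_intersecting: "finite {card \<F> | \<F>. alpha_intersecting \<alpha> n \<F>}"
proof -
  have "{card \<F> | \<F>. alpha_intersecting \<alpha> n \<F>} \<subseteq> card ` Pow (Pow {1..n})"
    by (auto simp: alpha_intersecting_def)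
  then show ?thesis
    by (rule finite_subset) simp
qed

lemma alpha_intersecting_empty: "alpha_intersecting \<alpha> n {}"
  by (auto simp: alpha_intersecting_def)

end

theory Submission
  imports Defs "HOL-Real_Asymp.Real_Asymp"
begin

text \<open>
  Put \<open>s = 2\<^sup>l\<close> and let \<open>m\<close> be the size of an intersecting family. For two \<open>s\<close>-subfamilies
  \<open>I, J\<close> the parity of the common intersection of \<open>I \<union> J\<close> is \<open>[card (I \<inter> J) \<ge> 2 s - t]\<close>. Expanded
  over \<open>F\<^sub>2\<close> in the indicators \<open>[K \<subseteq> I \<inter> J]\<close>, with coefficients depending on \<open>card K\<close>, it has a
  nonzero coefficient at \<open>card K = s\<close>, because \<open>(E - 1)\<^sup>s = E\<^sup>s - 1\<close> for the shift operator \<open>E\<close>. So the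
  Gram matrix of the \<open>s\<close>-fold intersections, whose rank is at most \<open>n\<close>, is the identity up to
  rank \<open>O(m\<^bsup>s-1\<^esup>)\<close>, and \<open>n \<ge> (m choose s) - O(m\<^bsup>s-1\<^esup>)\<close>.

  Conversely, dualise: an intersecting family with \<open>m\<close> members is a family of at most \<open>n\<close> subsets
  of an \<open>m\<close>-set in which the degree of each \<open>J\<close> with \<open>1 \<le> card J \<le> 2 s\<close> has the prescribed
  parity. The degrees for \<open>card J > s\<close> are realised by \<open>O(m\<^bsup>s-1\<^esup>)\<close> complements of small sets,
  and those for \<open>card J \<le> s\<close> are then corrected from the top down by sets of size at most \<open>s\<close>.
\<close>

section \<open>Finite differences over the field with two elements\<close>

declare add_bit_eq_xor [simp del] mult_bit_eq_and [simp del]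

lemma bit_add_self: "a + a = (0 :: bit)"
  by (cases a) simp_all

lemma bit_add_cancel: "a + (b + a) = (b :: bit)"
  by (cases a; cases b) simp_all

lemma of_nat_bit_eq: "(of_nat n :: bit) = of_bool (odd n)"
  by (induction n) auto

text \<open>The forward difference; in characteristic 2 the minus sign becomes
  \<open>+\<close>.\<close>

definition bit_diff :: "(nat \<Rightarrow> bit) \<Rightarrow> nat \<Rightarrow> bit" where
  "bit_diff h y = h (Suc y) + h y"

text \<open>Newton's forward difference formula, with subsets of \<open>D\<close> in place of
  binomial coefficients. Pairing \<open>K\<close> with \<open>insert x K\<close> is the identity
  "shift = 1 + difference"; it moves the base point, so \<open>y\<close> must vary in the
  induction.\<close>

lemma bit_diff_newton:
  assumes "finite D"
  shows "(\<Sum>K\<in>Pow D. (bit_diff ^^ card K) h y) = h (y + card D)"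
  using assms
proof (induction D arbitrary: y rule: finite_induct)
  case empty
  then show ?case by simp
next
  case (insert x D)
  have fin: "finite K" "x \<notin> K" if "K \<subseteq> D" for K
    using that insert.hyps by (auto intro: finite_subset)
  have inj: "inj_on (insert x) (Pow D)"
    using insert.hyps by (intro inj_onI) (auto simp: insert_ident fin)
  have "(\<Sum>K\<in>Pow (insert x D). (bit_diff ^^ card K) h y) =
      (\<Sum>K\<in>Pow D. (bit_diff ^^ card K) h y) + (\<Sum>K\<in>insert x ` Pow D. (bit_diff ^^ card K) h y)"
    unfolding Pow_insert using insert.hyps by (intro sum.union_disjoint) auto
  also have "(\<Sum>K\<in>insert x ` Pow D. (bit_diff ^^ card K) h y) =
      (\<Sum>K\<in>Pow D. (bit_diff ^^ Suc (card K)) h y)"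
    using inj by (simp add: sum.reindex fin)
  also have "\<dots> = (\<Sum>K\<in>Pow D. (bit_diff ^^ card K) h (Suc y)) + (\<Sum>K\<in>Pow D. (bit_diff ^^ card K) h y)"
    by (simp add: bit_diff_def sum.distrib)
  finally show ?case
    using insert by (simp add: bit_add_cancel)
qed

text \<open>The operator is \<open>E + 1\<close> for the shift \<open>E\<close>, and squaring is additive in characteristic \<open>2\<close>.\<close>

lemma bit_diff_funpow_two_power: "(bit_diff ^^ (2 ^ l)) h y = h (y + 2 ^ l) + h y"
proof (induction l arbitrary: h y)
  case 0
  then show ?case by (simp add: bit_diff_def)
next
  case (Suc l)
  have "(bit_diff ^^ (2 ^ Suc l)) h y = (bit_diff ^^ (2 ^ l)) ((bit_diff ^^ (2 ^ l)) h) y"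
    by (simp add: mult_2 funpow_add)
  also have "\<dots> = (h (y + 2 ^ Suc l) + h (y + 2 ^ l)) + (h (y + 2 ^ l) + h y)"
    by (simp add: Suc.IH mult_2 add.assoc)
  finally show ?case
    by (cases "h (y + 2 ^ l)") (simp_all add: ac_simps)
qed

text \<open>The difference of order \<open>2 ^ l\<close> compares values one period apart, so it
  vanishes, and so do all later ones.\<close>

lemma bit_diff_funpow_periodic_eq_0:
  assumes "\<And>y. h (y + 2 ^ l) = h y" and "2 ^ l \<le> i"
  shows "(bit_diff ^^ i) h y = 0"
proof -
  have zero: "(bit_diff ^^ (2 ^ l)) h = (\<lambda>_. 0)"
    by (rule ext) (simp add: bit_diff_funpow_two_power assms(1) bit_add_self)
  have "(bit_diff ^^ j) (\<lambda>_. 0) = (\<lambda>_. 0)" for j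
    by (induction j) (auto simp: bit_diff_def fun_eq_iff)
  moreover have "bit_diff ^^ i = (bit_diff ^^ (i - 2 ^ l)) \<circ> (bit_diff ^^ (2 ^ l))"
    using assms(2) by (simp flip: funpow_add)
  ultimately show ?thesis
    by (simp add: zero)
qed

section \<open>Upper bound by counting\<close>

lemma card_subsets_card_less:
  assumes "finite V"
  shows "card {A. A \<subseteq> V \<and> card A < s} = (\<Sum>i<s. card V choose i)"
proof -
  have "{A. A \<subseteq> V \<and> card A < s} = (\<Union>i\<in>{..<s}. {A. A \<subseteq> V \<and> card A = i})"
    by auto
  also have "card \<dots> = (\<Sum>i<s. card {A. A \<subseteq> V \<and> card A = i})"
    using assms by (intro card_UN_disjoint) auto
  finally show ?thesis
    using assms by (simp add: n_subsets)
qed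

text \<open>The intersection parities force \<open>\<S> \<mapsto> (P \<S>, Q \<S>)\<close> below to be injective: \<open>J \<in> \<S>\<close> can be
  read off from the pair.\<close>

lemma choose_le_of_parity:
  fixes \<F> :: "nat set set" and l n r :: nat
  defines "s \<equiv> 2 ^ l"
  assumes sub: "\<F> \<subseteq> Pow {1..n}" and r: "1 \<le> r" "r \<le> s"
    and par: "\<And>I J. I \<subseteq> \<F> \<Longrightarrow> J \<subseteq> \<F> \<Longrightarrow> card I = s \<Longrightarrow> card J = s \<Longrightarrow>
      (of_nat (card (\<Inter>(I \<union> J))) :: bit) = of_bool (r \<le> card (I \<inter> J))"
  shows "card \<F> choose s \<le> n + (\<Sum>i<s. card \<F> choose i)"
proof -
  have finF: "finite \<F>"
    using sub by (rule finite_subset) simp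
  have s: "s \<ge> 1"
    by (simp add: s_def)
  \<comment> \<open>Newton coefficients at 0 of the threshold function. The one of order
    \<open>s\<close> is its value at \<open>s\<close> plus its value at 0, that is 1 + 0, since
    \<open>1 \<le> r \<le> s\<close>.\<close>
  define c :: "nat \<Rightarrow> bit" where "c i = (bit_diff ^^ i) (\<lambda>x. of_bool (r \<le> x)) 0" for i
  have cs: "c s = 1"
    using r by (simp add: c_def s_def bit_diff_funpow_two_power)
  have newton: "of_bool (r \<le> card D) = (\<Sum>K\<in>Pow D. c (card K))" if "finite D" for D :: "nat set set"
    using bit_diff_newton[OF that, of "\<lambda>x. of_bool (r \<le> x)" 0] by (simp add: c_def)
  define X where "X = {I. I \<subseteq> \<F> \<and> card I = s}"
  define Y where "Y = {K. K \<subseteq> \<F> \<and> card K < s}"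
  have finX: "finite X" and finY: "finite Y"
    using finF by (auto simp: X_def Y_def)
  have finS: "finite \<S>" if "\<S> \<subseteq> X" for \<S>
    using that finX by (rule finite_subset)
  have X_fin: "finite I" if "I \<in> X" for I
    using that finF by (auto simp: X_def intro: finite_subset)
  have X_Inter: "\<Inter>J \<subseteq> {1..n}" if "J \<in> X" for J
  proof -
    from that s have "J \<noteq> {}" "J \<subseteq> \<F>"
      by (auto simp: X_def)
    with sub show ?thesis by auto
  qed
  \<comment> \<open>\<open>P\<close> is the mod 2 sum of the intersections, as vectors on the ground
    set; \<open>Q\<close> records what the Newton terms of order below \<open>s\<close>
    need.\<close>
  define P where "P \<S> = {x \<in> {1..n}. odd (card {I\<in>\<S>. x \<in> \<Inter>I})}" for \<S>
  define Q where "Q \<S> = {K \<in> Y. odd (card {I\<in>\<S>. K \<subseteq> I})}" for \<S>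
  have recover: "of_bool (J \<in> \<S>) =
      (\<Sum>x\<in>\<Inter>J. of_bool (x \<in> P \<S>)) + (\<Sum>K\<in>Pow J - {J}. c (card K) * of_bool (K \<in> Q \<S>))"
    if J: "J \<in> X" and \<S>: "\<S> \<subseteq> X" for J \<S>
  proof -
    have finJ: "finite (\<Inter>J)" "finite J"
      using X_Inter[OF J] X_fin[OF J] by (auto intro: finite_subset)
    have "(\<Sum>x\<in>\<Inter>J. of_bool (x \<in> P \<S>)) = (\<Sum>x\<in>\<Inter>J. of_nat (card {I\<in>\<S>. x \<in> \<Inter>I}) :: bit)"
      using X_Inter[OF J] by (intro sum.cong) (auto simp: P_def of_nat_bit_eq)
    also have "\<dots> = (\<Sum>x\<in>\<Inter>J. \<Sum>I\<in>\<S>. of_bool (x \<in> \<Inter>I))"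
      using finS[OF \<S>] by (intro sum.cong) (auto simp: sum_of_bool_eq Int_def)
    also have "\<dots> = (\<Sum>I\<in>\<S>. \<Sum>x\<in>\<Inter>J. of_bool (x \<in> \<Inter>I))"
      by (rule sum.swap)
    also have "\<dots> = (\<Sum>I\<in>\<S>. of_nat (card (\<Inter>(I \<union> J))))"
    proof (rule sum.cong[OF refl])
      fix I
      have "\<Inter>(I \<union> J) = \<Inter>J \<inter> {x. x \<in> \<Inter>I}" by auto
      then show "(\<Sum>x\<in>\<Inter>J. of_bool (x \<in> \<Inter>I)) = (of_nat (card (\<Inter>(I \<union> J))) :: bit)"
        using finJ by (simp only: sum_of_bool_eq)
    qed
    also have "\<dots> = (\<Sum>I\<in>\<S>. \<Sum>K\<in>Pow (I \<inter> J). c (card K))"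
    proof (rule sum.cong[OF refl])
      fix I assume "I \<in> \<S>"
      then have "of_nat (card (\<Inter>(I \<union> J))) = (of_bool (r \<le> card (I \<inter> J)) :: bit)"
        using J \<S> by (intro par) (auto simp: X_def)
      then show "of_nat (card (\<Inter>(I \<union> J))) = (\<Sum>K\<in>Pow (I \<inter> J). c (card K))"
        using newton[of "I \<inter> J"] finJ by simp
    qed
    also have "\<dots> = (\<Sum>I\<in>\<S>. \<Sum>K\<in>Pow J. c (card K) * of_bool (K \<subseteq> I))"
      using finJ by (intro sum.cong sum.mono_neutral_cong_left) auto
    also have "\<dots> = (\<Sum>K\<in>Pow J. c (card K) * (\<Sum>I\<in>\<S>. of_bool (K \<subseteq> I)))"
      by (subst sum.swap) (simp add: sum_distrib_left)
    also have "\<dots> = (\<Sum>K\<in>Pow J. c (card K) * of_nat (card {I\<in>\<S>. K \<subseteq> I}))"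
      using finS[OF \<S>] by (simp add: sum_of_bool_eq Int_def)
    also have "\<dots> = c (card J) * of_nat (card {I\<in>\<S>. J \<subseteq> I}) +
        (\<Sum>K\<in>Pow J - {J}. c (card K) * of_nat (card {I\<in>\<S>. K \<subseteq> I}))"
      using finJ by (subst sum.remove[of "Pow J" J]) auto
    finally have expand: "(\<Sum>x\<in>\<Inter>J. of_bool (x \<in> P \<S>)) = c (card J) * of_nat (card {I\<in>\<S>. J \<subseteq> I}) +
        (\<Sum>K\<in>Pow J - {J}. c (card K) * of_nat (card {I\<in>\<S>. K \<subseteq> I}))" .
    \<comment> \<open>All members of \<open>X\<close> have size \<open>s\<close>, so the term
      \<open>K = J\<close> isolates membership of \<open>J\<close>.\<close>
    have top: "{I\<in>\<S>. J \<subseteq> I} = (if J \<in> \<S> then {J} else {})"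
    proof -
      have "I = J" if "I \<in> \<S>" "J \<subseteq> I" for I
      proof -
        have "I \<in> X"
          using that \<S> by blast
        then have "J = I"
          using that J by (intro card_subset_eq X_fin) (simp_all add: X_def)
        then show ?thesis ..
      qed
      then show ?thesis by (cases "J \<in> \<S>") auto
    qed
    have "c (card J) * of_nat (card {I\<in>\<S>. J \<subseteq> I}) = of_bool (J \<in> \<S>)"
      using J cs unfolding X_def top by (cases "J \<in> \<S>") simp_all
    moreover have "(\<Sum>K\<in>Pow J - {J}. c (card K) * of_nat (card {I\<in>\<S>. K \<subseteq> I})) =
        (\<Sum>K\<in>Pow J - {J}. c (card K) * of_bool (K \<in> Q \<S>))"
    proof (rule sum.cong[OF refl])
      fix K assume "K \<in> Pow J - {J}"
      then have "K \<subset> J" by auto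
      then have "K \<in> Y"
        using psubset_card_mono[OF finJ(2)] J by (auto simp: X_def Y_def)
      then show "c (card K) * of_nat (card {I\<in>\<S>. K \<subseteq> I}) = c (card K) * of_bool (K \<in> Q \<S>)"
        by (simp add: Q_def of_nat_bit_eq)
    qed
    ultimately show ?thesis
      unfolding expand by (simp add: add.assoc bit_add_self)
  qed
  have "inj_on (\<lambda>\<S>. (P \<S>, Q \<S>)) (Pow X)"
  proof (rule inj_onI)
    fix \<S> \<S>' assume *: "\<S> \<in> Pow X" "\<S>' \<in> Pow X" "(P \<S>, Q \<S>) = (P \<S>', Q \<S>')"
    have "J \<in> \<S> \<longleftrightarrow> J \<in> \<S>'" if "J \<in> X" for J
    proof -
      have "of_bool (J \<in> \<S>) = (of_bool (J \<in> \<S>') :: bit)"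
        using recover[OF that, of \<S>] recover[OF that, of \<S>'] * by simp
      then show ?thesis by (simp only: of_bool_eq_iff)
    qed
    with * show "\<S> = \<S>'" by blast
  qed
  moreover have "(\<lambda>\<S>. (P \<S>, Q \<S>)) ` Pow X \<subseteq> Pow {1..n} \<times> Pow Y"
    by (auto simp: P_def Q_def)
  \<comment> \<open>Comparing the sizes of power sets takes the place of a rank inequality.\<close>
  ultimately have "card (Pow X) \<le> card (Pow {1..n} \<times> Pow Y)"
    using finY by (intro card_inj_on_le) auto
  then have "(2 :: nat) ^ card X \<le> 2 ^ (n + card Y)"
    using finX finY by (simp add: card_Pow card_cartesian_product power_add)
  then have "card X \<le> n + card Y"
    by simp
  then show ?thesis
    using finF by (simp add: X_def Y_def n_subsets card_subsets_card_less)
qed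

section \<open>Dual set systems with prescribed degree parities\<close>

text \<open>The sets of size \<open>Suc s\<close> in the system are forced by \<open>g\<close>,
  since no smaller set contains a \<open>J\<close> of that size. Their effect on smaller
  \<open>J\<close> is added to \<open>g\<close> before the induction hypothesis is used, so
  \<open>g\<close> must vary.\<close>

lemma exists_subsets_with_degree_parity:
  fixes g :: "'a set \<Rightarrow> bit"
  assumes "finite V"
  shows "\<exists>B. B \<subseteq> {A. A \<subseteq> V \<and> 1 \<le> card A \<and> card A \<le> s} \<and>
    (\<forall>J\<subseteq>V. 1 \<le> card J \<and> card J \<le> s \<longrightarrow> of_nat (card {A\<in>B. J \<subseteq> A}) = g J)"
proof (induction s arbitrary: g)
  case 0
  show ?case by (rule exI[of _ "{}"]) (simp cong: conj_cong)
next
  case (Suc s)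
  define T where "T = {J. J \<subseteq> V \<and> card J = Suc s \<and> g J = 1}"
  obtain B where B: "B \<subseteq> {A. A \<subseteq> V \<and> 1 \<le> card A \<and> card A \<le> s}"
    and cnt: "\<And>J. J \<subseteq> V \<Longrightarrow> 1 \<le> card J \<Longrightarrow> card J \<le> s \<Longrightarrow>
      of_nat (card {A\<in>B. J \<subseteq> A}) = g J + of_nat (card {A\<in>T. J \<subseteq> A})"
    using Suc.IH[of "\<lambda>J. g J + of_nat (card {A\<in>T. J \<subseteq> A})"] by (elim exE conjE) simp
  have fin: "finite T" "finite B"
    using B assms by (auto simp: T_def intro: finite_subset[of _ "Pow V"])
  have finV: "finite A" if "A \<subseteq> V" for A
    using that assms by (rule finite_subset)
  have union: "card {A\<in>T \<union> B. J \<subseteq> A} = card {A\<in>T. J \<subseteq> A} + card {A\<in>B. J \<subseteq> A}" for J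
  proof -
    have "{A\<in>T \<union> B. J \<subseteq> A} = {A\<in>T. J \<subseteq> A} \<union> {A\<in>B. J \<subseteq> A}" by auto
    moreover have "{A\<in>T. J \<subseteq> A} \<inter> {A\<in>B. J \<subseteq> A} = {}"
      using B by (auto simp: T_def)
    ultimately show ?thesis
      using fin by (simp add: card_Un_disjoint)
  qed
  have "of_nat (card {A\<in>T \<union> B. J \<subseteq> A}) = g J" if J: "J \<subseteq> V" "1 \<le> card J" "card J \<le> Suc s" for J
  proof (cases "card J = Suc s")
    case True
    have only_J: "A = J" if "A \<in> T" "J \<subseteq> A" for A
    proof -
      have "J = A"
        using that True by (intro card_subset_eq finV) (simp_all add: T_def)
      then show ?thesis ..
    qed
    have top: "{A\<in>T. J \<subseteq> A} = T \<inter> {J}"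
    proof (intro equalityI subsetI)
      fix A assume A: "A \<in> {A\<in>T. J \<subseteq> A}"
      then have "A = J"
        by (intro only_J) simp_all
      then show "A \<in> T \<inter> {J}"
        using A by simp
    qed auto
    have "J \<in> T \<longleftrightarrow> g J = 1"
      using J True by (simp add: T_def)
    moreover have "A \<notin> B" if "J \<subseteq> A" for A
    proof
      assume "A \<in> B"
      then have "A \<subseteq> V" "card A \<le> s"
        using B by auto
      then show False
        using card_mono[OF finV that] True by simp
    qed
    then have none: "{A\<in>B. J \<subseteq> A} = {}"
      by blast
    ultimately show ?thesis
      unfolding union top none by (cases "g J = 1") simp_all
  next
    case False
    then show ?thesis
      using cnt[of J] J unfolding union by (simp add: bit_add_cancel)
  qed
  moreover have "T \<union> B \<subseteq> {A. A \<subseteq> V \<and> 1 \<le> card A \<and> card A \<le> Suc s}"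
    using B by (auto simp: T_def)
  ultimately show ?case by blast
qed

text \<open>The intersecting family lives on the ground set \<open>U\<close>: its members are indexed by \<open>V\<close>, and
  \<open>i \<in> V\<close> gives the set of all \<open>A \<in> U\<close> containing \<open>i\<close>.\<close>

lemma max_alpha_intersecting_ge_dual:
  fixes U :: "'a set set"
  assumes V: "finite V" and U: "U \<subseteq> Pow V" "card U \<le> n"
    and deg: "\<And>J. J \<subseteq> V \<Longrightarrow> 1 \<le> card J \<Longrightarrow> card J \<le> length \<alpha> \<Longrightarrow>
      of_nat (card {A\<in>U. J \<subseteq> A}) = \<alpha> ! (card J - 1)"
    and t: "1 \<le> t" "t < length \<alpha>" "t < card V" "\<alpha> ! (t - 1) \<noteq> \<alpha> ! t"
  shows "card V \<le> max_alpha_intersecting \<alpha> n"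
proof -
  have finU: "finite U"
    using U(1) V by (auto intro: finite_subset)
  then obtain \<phi> where \<phi>: "inj_on \<phi> U" "\<phi> ` U \<subseteq> {1..n}"
    using card_le_inj[OF finU, of "{1..n}"] U(2) by auto
  define F where "F i = \<phi> ` {A\<in>U. i \<in> A}" for i
  have Inter_F: "\<Inter>(F ` J) = \<phi> ` {A\<in>U. J \<subseteq> A}" if "J \<noteq> {}" for J
  proof
    show "\<phi> ` {A\<in>U. J \<subseteq> A} \<subseteq> \<Inter>(F ` J)"
      by (auto simp: F_def)
    show "\<Inter>(F ` J) \<subseteq> \<phi> ` {A\<in>U. J \<subseteq> A}"
    proof
      fix x assume x: "x \<in> \<Inter>(F ` J)"
      from that obtain i where "i \<in> J" by auto
      with x obtain A where A: "A \<in> U" "x = \<phi> A"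
        by (auto simp: F_def)
      have "j \<in> A" if "j \<in> J" for j
      proof -
        from x that obtain A' where "A' \<in> U" "j \<in> A'" "x = \<phi> A'"
          by (auto simp: F_def)
        with A \<phi>(1) show ?thesis by (auto dest: inj_onD)
      qed
      with A show "x \<in> \<phi> ` {A\<in>U. J \<subseteq> A}" by auto
    qed
  qed
  have card_Inter: "of_nat (card (\<Inter>(F ` J))) = \<alpha> ! (card J - 1)"
    if "J \<subseteq> V" "1 \<le> card J" "card J \<le> length \<alpha>" for J
  proof -
    have "card (\<Inter>(F ` J)) = card {A\<in>U. J \<subseteq> A}"
      using that(2) \<phi>(1) by (subst Inter_F) (auto intro!: card_image inj_on_subset[OF \<phi>(1)])
    then show ?thesis
      using deg that by simp
  qed
  have inj: "inj_on F V"
  proof (rule inj_onI, rule ccontr)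
    fix i i' assume i: "i \<in> V" "i' \<in> V" "F i = F i'" "i \<noteq> i'"
    \<comment> \<open>With \<open>t - 1\<close> further indices, \<open>F i = F i'\<close> would
      make a \<open>t\<close>-fold and a \<open>t + 1\<close>-fold intersection coincide, although
      their prescribed parities differ.\<close>
    have "t - 1 \<le> card (V - {i, i'})"
      using i t V by (simp add: card_Diff_subset)
    then obtain K where K: "K \<subseteq> V - {i, i'}" "card K = t - 1" "finite K"
      using obtain_subset_with_card_n by metis
    have "F ` insert i K = F ` insert i (insert i' K)"
      using i by auto
    moreover have "card (insert i K) = t" "card (insert i (insert i' K)) = Suc t"
      using K i t by (auto simp: card_insert_if)
    ultimately show False
      using card_Inter[of "insert i K"] card_Inter[of "insert i (insert i' K)"] K i t
      by auto
  qed
  have "alpha_intersecting \<alpha> n (F ` V)"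
    unfolding alpha_intersecting_def
  proof (intro conjI ballI allI impI)
    show "F ` V \<subseteq> Pow {1..n}"
      using \<phi>(2) by (auto simp: F_def)
    fix j \<G> assume j: "j \<in> {1..length \<alpha>}" "\<G> \<subseteq> F ` V" "card \<G> = j"
    then obtain J where J: "J \<subseteq> V" "\<G> = F ` J"
      by (auto simp: subset_image_iff)
    then have "card J = j"
      using j inj by (metis card_image inj_on_subset)
    then show "of_nat (card (\<Inter>\<G>)) = \<alpha> ! (j - 1)"
      using card_Inter[of J] J j by auto
  qed
  then have "card (F ` V) \<le> max_alpha_intersecting \<alpha> n"
    unfolding max_alpha_intersecting_def
    by (intro Max_ge finite_card_alpha_intersecting) auto
  then show ?thesis
    using inj by (simp add: card_image)
qed

section \<open>Both bounds for a vector of ones followed by zeros\<close>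

lemma nth_ones_zeros:
  assumes "1 \<le> j" "j \<le> k" "t \<le> k"
  shows "(replicate t 1 @ replicate (k - t) 0 :: bit list) ! (j - 1) = of_bool (j \<le> t)"
  using assms by (auto simp: nth_append)

text \<open>Two \<open>s\<close>-subfamilies have a union of size
  \<open>2 * s - card (I \<inter> J)\<close>, so the threshold is \<open>r = 2 * s - t\<close>. The
  range of \<open>t\<close> gives \<open>1 \<le> r \<le> s\<close>.\<close>

lemma max_ones_zeros_intersecting_choose_le:
  fixes l t n :: nat and \<alpha> :: "bit list"
  defines "s \<equiv> 2 ^ l" and "\<alpha> \<equiv> replicate t 1 @ replicate (2 * 2 ^ l - t) 0"
  assumes t: "s \<le> t" "t < 2 * s"
  shows "max_alpha_intersecting \<alpha> n choose s \<le> n + (\<Sum>i<s. max_alpha_intersecting \<alpha> n choose i)"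
proof -
  have "max_alpha_intersecting \<alpha> n \<in> {card \<F> | \<F>. alpha_intersecting \<alpha> n \<F>}"
    unfolding max_alpha_intersecting_def
    using finite_card_alpha_intersecting alpha_intersecting_empty[of \<alpha> n] by (intro Max_in) blast+
  then obtain \<F> where \<F>: "alpha_intersecting \<alpha> n \<F>" "max_alpha_intersecting \<alpha> n = card \<F>"
    by auto
  have sub: "\<F> \<subseteq> Pow {1..n}"
    using \<F>(1) by (simp add: alpha_intersecting_def)
  have finF: "finite \<F>"
    using sub by (rule finite_subset) simp
  have len: "length \<alpha> = 2 * s"
    using t by (simp add: \<alpha>_def s_def)
  have "card \<F> choose 2 ^ l \<le> n + (\<Sum>i<2 ^ l. card \<F> choose i)"
  proof (rule choose_le_of_parity[OF sub, of "2 * s - t"])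
    show "1 \<le> 2 * s - t" "2 * s - t \<le> 2 ^ l"
      using t by (auto simp: s_def)
    fix I J assume IJ: "I \<subseteq> \<F>" "J \<subseteq> \<F>" "card I = 2 ^ l" "card J = 2 ^ l"
    have fin: "finite I" "finite J"
      using IJ finF by (auto intro: finite_subset)
    have card: "card (I \<union> J) + card (I \<inter> J) = 2 * s"
      using card_Un_Int[OF fin] IJ by (simp add: s_def)
    have le: "card (I \<inter> J) \<le> s"
      using card_mono[of I "I \<inter> J"] fin IJ by (simp add: s_def)
    have "s \<ge> 1"
      by (simp add: s_def)
    then have rng: "1 \<le> card (I \<union> J)" "card (I \<union> J) \<le> 2 * s"
      using card le by linarith+
    then have "of_nat (card (\<Inter>(I \<union> J))) = \<alpha> ! (card (I \<union> J) - 1)"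
      using \<F>(1) IJ len unfolding alpha_intersecting_def by auto
    also have "\<dots> = of_bool (card (I \<union> J) \<le> t)"
      using rng t nth_ones_zeros[of "card (I \<union> J)" "2 * s" t] by (simp add: \<alpha>_def s_def)
    also have "card (I \<union> J) \<le> t \<longleftrightarrow> 2 * s - t \<le> card (I \<inter> J)"
      using card t by linarith
    finally show "of_nat (card (\<Inter>(I \<union> J))) = (of_bool (2 * s - t \<le> card (I \<inter> J)) :: bit)" .
  qed
  then show ?thesis
    by (simp add: \<F>(2) s_def)
qed

text \<open>Complements of sets of size below \<open>s\<close> produce every \<open>s\<close>-periodic parity pattern, in
  particular the right one for \<open>s < card J\<close>; sets of size at most \<open>s\<close> then repair the smaller
  \<open>J\<close> without affecting the larger ones.\<close>

lemma max_ones_zeros_intersecting_ge: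
  fixes l t n m :: nat and \<alpha> :: "bit list"
  defines "s \<equiv> 2 ^ l" and "\<alpha> \<equiv> replicate t 1 @ replicate (2 * 2 ^ l - t) 0"
  assumes t: "s \<le> t" "t < 2 * s" and m: "2 * s \<le> m"
    and n: "(m choose s) + 2 * (\<Sum>i<s. m choose i) \<le> n"
  shows "m \<le> max_alpha_intersecting \<alpha> n"
proof -
  define V where "V = {..<m}"
  have V: "finite V" "card V = m"
    by (simp_all add: V_def)
  have finV: "finite A" if "A \<subseteq> V" for A
    using that V(1) by (rule finite_subset)
  have s: "s \<ge> 1"
    by (simp add: s_def)
  have len: "length \<alpha> = 2 * s"
    using t by (simp add: \<alpha>_def s_def)
  have nth: "\<alpha> ! (j - 1) = of_bool (j \<le> t)" if "1 \<le> j" "j \<le> 2 * s" for j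
    using that t nth_ones_zeros[of j "2 * s" t] by (simp add: \<alpha>_def s_def)
  \<comment> \<open>Here \<open>y\<close> stands for \<open>m - j\<close>. For
    \<open>s < j \<le> 2 * s\<close> the residue of \<open>-j\<close> is \<open>2 * s - j\<close>,
    which reaches \<open>2 * s - t\<close> iff \<open>j \<le> t\<close>. Integers avoid truncation
    for \<open>y < m\<close>.\<close>
  define h :: "nat \<Rightarrow> bit"
    where "h y = of_bool (int (2 * s - t) \<le> (int y - int m) mod int s)" for y
  have h_periodic: "h (y + 2 ^ l) = h y" for y
  proof -
    have "(int (y + s) - int m) mod int s = (int y - int m + int s) mod int s"
      by (simp add: algebra_simps)
    then show ?thesis
      by (simp add: h_def flip: s_def)
  qed
  have h_eq: "h (m - j) = of_bool (j \<le> t)" if "s < j" "j \<le> 2 * s" for j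
  proof -
    have "(int (m - j) - int m) mod int s = (int (2 * s - j) - 2 * int s) mod int s"
      using that m by (simp add: algebra_simps)
    also have "\<dots> = int (2 * s - j) mod int s"
      by (metis mod_diff_right_eq mod_mult_self2_is_0 diff_zero mult.commute)
    also have "\<dots> = int (2 * s - j)"
      using that by (intro mod_pos_pos_trivial) auto
    finally show ?thesis
      using that t unfolding h_def by (intro arg_cong[of _ _ of_bool]) auto
  qed
  \<comment> \<open>Newton coefficients of \<open>h\<close> at 0; periodicity leaves only orders
    below \<open>s\<close>.\<close>
  define e where "e i = (bit_diff ^^ i) h 0" for i
  have e_small: "i < s" if "e i = 1" for i
    using bit_diff_funpow_periodic_eq_0[of h l i 0, OF h_periodic] that
    by (force simp: e_def s_def not_less)
  define C where "C = {K. K \<subseteq> V \<and> e (card K) = 1}"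
  define W where "W = (\<lambda>K. V - K) ` C"
  have C_sub: "C \<subseteq> {A. A \<subseteq> V \<and> card A < s}"
    by (auto simp: C_def e_small)
  have inj: "inj_on (\<lambda>K. V - K) C"
    by (auto simp: inj_on_def C_def)
  have finC: "finite C"
    using V by (auto simp: C_def)
  have W_deg: "of_nat (card {A\<in>W. J \<subseteq> A}) = h (m - card J)" if "J \<subseteq> V" for J
  proof -
    \<comment> \<open>A complement contains \<open>J\<close> iff the removed set avoids
      \<open>J\<close>, so the degree is a Newton sum over \<open>V - J\<close>.\<close>
    have "{A\<in>W. J \<subseteq> A} = (\<lambda>K. V - K) ` {K\<in>C. K \<subseteq> V - J}"
      using that by (auto simp: W_def C_def)
    then have "card {A\<in>W. J \<subseteq> A} = card {K\<in>C. K \<subseteq> V - J}"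
      using inj by (simp add: card_image inj_on_subset)
    moreover have "{K\<in>C. K \<subseteq> V - J} = Pow (V - J) \<inter> {K. e (card K) = 1}"
      by (auto simp: C_def)
    moreover have "of_nat (card (Pow (V - J) \<inter> {K. e (card K) = 1})) =
        (\<Sum>K\<in>Pow (V - J). of_bool (e (card K) = 1) :: bit)"
      using V by (simp add: sum_of_bool_eq)
    moreover have "\<dots> = (\<Sum>K\<in>Pow (V - J). e (card K))"
      by (intro sum.cong) (auto split: bit.splits)
    moreover have "\<dots> = h (m - card J)"
      using bit_diff_newton[of "V - J" h 0] V that finV[OF that]
      by (simp add: e_def card_Diff_subset)
    ultimately show ?thesis by simp
  qed
  \<comment> \<open>Since \<open>m \<ge> 2 * s\<close>, the complements are too large to lie in
    \<open>B\<close>, so degrees in \<open>W\<close> and \<open>B\<close> add up.\<close>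
  have W_large: "s < card A" "A \<subseteq> V" if A: "A \<in> W" for A
  proof -
    from A obtain K where K: "K \<in> C" "A = V - K"
      by (auto simp: W_def)
    then have "K \<subseteq> V" "card K < s"
      using C_sub by auto
    then show "s < card A" "A \<subseteq> V"
      using V m K(2) finV[of K] by (auto simp: card_Diff_subset)
  qed
  obtain B where B: "B \<subseteq> {A. A \<subseteq> V \<and> 1 \<le> card A \<and> card A \<le> s}"
    and B_deg: "\<And>J. J \<subseteq> V \<Longrightarrow> 1 \<le> card J \<Longrightarrow> card J \<le> s \<Longrightarrow>
      of_nat (card {A\<in>B. J \<subseteq> A}) = \<alpha> ! (card J - 1) + of_nat (card {A\<in>W. J \<subseteq> A})"
    using exists_subsets_with_degree_parity[OF V(1), of s
        "\<lambda>J. \<alpha> ! (card J - 1) + of_nat (card {A\<in>W. J \<subseteq> A})"]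
    by (elim exE conjE) simp
  have finB: "finite B" and finW: "finite W"
    using B V finC by (auto simp: W_def intro: finite_subset[of _ "Pow V"])
  have "m = card V"
    by (simp add: V)
  also have "\<dots> \<le> max_alpha_intersecting \<alpha> n"
  proof (rule max_alpha_intersecting_ge_dual[OF V(1), of "W \<union> B" _ _ t])
    show "W \<union> B \<subseteq> Pow V"
      using W_large B by auto
    \<comment> \<open>The hypothesis on \<open>n\<close> pays for the orders below \<open>s\<close>
      twice, in \<open>W\<close> and in \<open>B\<close>, and for order \<open>s\<close> once, in
      \<open>B\<close>.\<close>
    have "card W \<le> (\<Sum>i<s. m choose i)"
      using card_mono[OF _ C_sub] V by (simp add: W_def card_image inj card_subsets_card_less)
    moreover have "card B \<le> (\<Sum>i<Suc s. m choose i)"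
    proof -
      have "B \<subseteq> {A. A \<subseteq> V \<and> card A < Suc s}"
        using B by (auto simp: less_Suc_eq_le)
      then show ?thesis
        using card_mono[of "{A. A \<subseteq> V \<and> card A < Suc s}" B] V(1)
        by (simp only: card_subsets_card_less[OF V(1)] V(2)) simp
    qed
    ultimately show "card (W \<union> B) \<le> n"
      using card_Un_le[of W B] n by simp
    show "1 \<le> t" "t < length \<alpha>" "t < card V"
      using s t m len V by auto
    show "\<alpha> ! (t - 1) \<noteq> \<alpha> ! t"
      using nth[of t] nth[of "Suc t"] s t by auto
    fix J assume J: "J \<subseteq> V" "1 \<le> card J" "card J \<le> length \<alpha>"
    have "{A\<in>W \<union> B. J \<subseteq> A} = {A\<in>W. J \<subseteq> A} \<union> {A\<in>B. J \<subseteq> A}" by auto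
    moreover have "{A\<in>W. J \<subseteq> A} \<inter> {A\<in>B. J \<subseteq> A} = {}"
      using B W_large(1) by force
    ultimately have union: "card {A\<in>W \<union> B. J \<subseteq> A} = card {A\<in>W. J \<subseteq> A} + card {A\<in>B. J \<subseteq> A}"
      using finB finW by (simp add: card_Un_disjoint)
    show "of_nat (card {A\<in>W \<union> B. J \<subseteq> A}) = \<alpha> ! (card J - 1)"
    proof (cases "card J \<le> s")
      case True
      then show ?thesis
        using B_deg[of J] J unfolding union by (simp add: bit_add_cancel)
    next
      case False
      have "A \<notin> B" if "J \<subseteq> A" for A
      proof
        assume "A \<in> B"
        then have "A \<subseteq> V" "card A \<le> s"
          using B by auto
        then show False
          using card_mono[OF finV that] False by simp
      qed
      then have none: "{A\<in>B. J \<subseteq> A} = {}"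
        by blast
      show ?thesis
        using False W_deg[OF J(1)] h_eq[of "card J"] nth[of "card J"] J len
        unfolding union none by simp
    qed
  qed
  finally show ?thesis .
qed

section \<open>Asymptotics and inversion of the bounds\<close>

lemma choose_asymp_equiv:
  "(\<lambda>m. real (m choose i)) \<sim>[sequentially] (\<lambda>m. real m ^ i / fact i)"
proof (induction i)
  case 0
  then show ?case by simp
next
  case (Suc i)
  have "(\<lambda>m. real m - real i) \<sim>[sequentially] real"
    by real_asymp
  from asymp_equiv_divide[OF asymp_equiv_mult[OF Suc.IH this] asymp_equiv_refl[of "\<lambda>_. real (Suc i)"]]
  have *: "(\<lambda>m. real (m choose i) * (real m - real i) / real (Suc i)) \<sim>[sequentially]
      (\<lambda>m. real m ^ i / fact i * real m / real (Suc i))" .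
  have "(\<lambda>m. real m ^ i / fact i * real m / real (Suc i)) = (\<lambda>m. real m ^ Suc i / fact (Suc i))"
    by (simp add: ac_simps)
  moreover have "real (m choose i) * (real m - real i) / real (Suc i) = real (m choose Suc i)" for m
    using gbinomial_mult_1[of "real m" i] by (simp add: binomial_gbinomial field_simps)
  ultimately show ?case
    using * by (simp only:)
qed

text \<open>The lower binomials are of smaller order, whatever the factor \<open>c\<close>; one
  bound needs \<open>c = 2\<close>, the other \<open>c = -1\<close>.\<close>

lemma choose_plus_lower_asymp_equiv:
  "(\<lambda>m. real (m choose s) + c * real (\<Sum>i<s. m choose i)) \<sim>[sequentially] (\<lambda>m. real m ^ s / fact s)"
proof -
  have "(\<lambda>m. real (m choose i)) \<in> o(\<lambda>m. real m ^ s / fact s)" if "i < s" for i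
  proof -
    have "(\<lambda>m. real (m choose i)) \<in> O(\<lambda>m. real m ^ i / fact i)"
      by (rule asymp_equiv_imp_bigo[OF choose_asymp_equiv])
    also have "(\<lambda>m. real m ^ i / fact i) \<in> o(\<lambda>m. real m ^ s / fact s)"
      using that by real_asymp
    finally show ?thesis .
  qed
  then have "(\<lambda>m. c * real (\<Sum>i<s. m choose i)) \<in> o(\<lambda>m. real m ^ s / fact s)"
    by (auto intro!: big_sum_in_smallo)
  then show ?thesis
    by (simp add: asymp_equiv_add_right choose_asymp_equiv)
qed

text \<open>Eventually \<open>n\<close> lies between \<open>Q (f n)\<close> and
  \<open>P (Suc (f n))\<close>, both asymptotic to \<open>f n ^ s / c\<close>; taking
  \<open>s\<close>-th roots inverts this.\<close>

lemma asymp_equiv_of_inverse_bounds: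
  fixes f :: "nat \<Rightarrow> nat" and P Q :: "nat \<Rightarrow> real" and c :: real
  assumes s: "s \<ge> 1" and c: "c > 0"
    and P: "P \<sim>[sequentially] (\<lambda>m. real m ^ s / c)" and Q: "Q \<sim>[sequentially] (\<lambda>m. real m ^ s / c)"
    and lower: "\<And>m n. M \<le> m \<Longrightarrow> P m \<le> real n \<Longrightarrow> m \<le> f n"
    and upper: "\<And>n. Q (f n) \<le> real n"
  shows "(\<lambda>n. real (f n)) \<sim>[sequentially] (\<lambda>n. (c * real n) powr (1 / real s))"
proof -
  have top: "filterlim f at_top sequentially"
    unfolding filterlim_at_top
  proof
    fix K
    \<comment> \<open>\<open>P (max K M)\<close> does not depend on \<open>n\<close>.\<close>
    have "eventually (\<lambda>n. P (max K M) \<le> real n) sequentially"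
      by real_asymp
    then show "eventually (\<lambda>n. K \<le> f n) sequentially"
      by eventually_elim (use lower[of "max K M"] in force)
  qed
  have top': "filterlim (\<lambda>n. Suc (f n)) at_top sequentially"
    using filterlim_compose[OF filterlim_Suc top] .
  have "(\<lambda>n. real n) \<sim>[sequentially] (\<lambda>n. real (f n) ^ s / c)"
  proof (rule asymp_equiv_sandwich_real)
    show "(\<lambda>n. Q (f n)) \<sim>[sequentially] (\<lambda>n. real (f n) ^ s / c)"
      using asymp_equiv_compose'[OF Q top] .
    have "(\<lambda>m. real (Suc m) ^ s / c) \<sim>[sequentially] (\<lambda>m. real m ^ s / c)"
    proof (intro asymp_equiv_intros)
      show "(\<lambda>m. real (Suc m)) \<sim>[sequentially] real"
        by real_asymp
    qed
    from asymp_equiv_compose'[OF this top]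
    show "(\<lambda>n. P (Suc (f n))) \<sim>[sequentially] (\<lambda>n. real (f n) ^ s / c)"
      using asymp_equiv_trans[OF asymp_equiv_compose'[OF P top']] by blast
    have "eventually (\<lambda>n. M \<le> f n) sequentially"
      using top by (simp add: filterlim_at_top)
    then show "eventually (\<lambda>n. real n \<in> {Q (f n)..P (Suc (f n))}) sequentially"
    proof eventually_elim
      case (elim n)
      \<comment> \<open>If \<open>P (Suc (f n)) \<le> n\<close>, then \<open>lower\<close> would
        give \<open>Suc (f n) \<le> f n\<close>.\<close>
      then show ?case
        using upper[of n] lower[of "Suc (f n)" n] by force
    qed
  qed
  then have "(\<lambda>n. c * real n) \<sim>[sequentially] (\<lambda>n. c * (real (f n) ^ s / c))"
    by (intro asymp_equiv_intros)
  then have "(\<lambda>n. (c * real n) powr (1 / real s)) \<sim>[sequentially]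
      (\<lambda>n. (c * (real (f n) ^ s / c)) powr (1 / real s))"
    using c by (intro asymp_equiv_powr_real) auto
  also have "(\<lambda>n. (c * (real (f n) ^ s / c)) powr (1 / real s)) = (\<lambda>n. real (f n))"
  proof
    fix n
    show "(c * (real (f n) ^ s / c)) powr (1 / real s) = real (f n)"
      using c s by (cases "f n = 0") (simp_all add: powr_powr flip: powr_realpow)
  qed
  finally show ?thesis
    by (rule asymp_equiv_symI)
qed

theorem corollaryV1:
  fixes k l t :: nat and \<alpha> :: "bit list"
  assumes "l \<ge> 1"
    and "k = 2 ^ (l + 1)"
    and "2 ^ l \<le> t" and "t \<le> k - 1"
    and "\<alpha> = replicate t 1 @ replicate (k - t) 0"
  shows "(\<lambda>n. real (max_alpha_intersecting \<alpha> n))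
           \<sim>[sequentially] (\<lambda>n. (fact (2 ^ l) * real n) powr (1 / 2 ^ l))"
proof -
  have t: "2 ^ l \<le> t" "t < 2 * 2 ^ l"
    using assms(2-4) by (auto simp: less_eq_Suc_le[symmetric] intro: le_less_trans)
  have \<alpha>: "\<alpha> = replicate t 1 @ replicate (2 * 2 ^ l - t) 0"
    using assms(2,5) by simp
  have "(\<lambda>n. real (max_alpha_intersecting \<alpha> n)) \<sim>[sequentially]
      (\<lambda>n. (fact (2 ^ l) * real n) powr (1 / real (2 ^ l)))"
  proof (rule asymp_equiv_of_inverse_bounds)
    let ?s = "2 ^ l :: nat"
    show "(\<lambda>m. real (m choose ?s) + 2 * real (\<Sum>i<?s. m choose i)) \<sim>[sequentially]
        (\<lambda>m. real m ^ ?s / fact ?s)"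
      by (rule choose_plus_lower_asymp_equiv)
    show "(\<lambda>m. real (m choose ?s) + (- 1) * real (\<Sum>i<?s. m choose i)) \<sim>[sequentially]
        (\<lambda>m. real m ^ ?s / fact ?s)"
      by (rule choose_plus_lower_asymp_equiv)
    fix n
    show "real (max_alpha_intersecting \<alpha> n choose ?s) +
        (- 1) * real (\<Sum>i<?s. max_alpha_intersecting \<alpha> n choose i) \<le> real n"
      using max_ones_zeros_intersecting_choose_le[OF t, of n] unfolding \<alpha>
      by (simp only: of_nat_le_iff[where 'a = real, symmetric] of_nat_add)
    fix m
    assume "2 * ?s \<le> m" "real (m choose ?s) + 2 * real (\<Sum>i<?s. m choose i) \<le> real n"
    then show "m \<le> max_alpha_intersecting \<alpha> n"
      unfolding \<alpha> by (intro max_ones_zeros_intersecting_ge[OF t]) linarith+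
  qed simp_all
  then show ?thesis
    by simp
qed

end
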